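(* Let $m,n,k$ be positive integers. Let $\mathcal{A}$ be the set of all real $m\times n$ doubly substochastic matrices, i.e. matrices $E=(e_{i,j})$ with $e_{i,j}\ge 0$ for all $i,j$, $\sum_{j=1}^n e_{i,j}\le 1$ for every $i=1,\dots,m$, and $\sum_{i=1}^m e_{i,j}\le 1$ for every $j=1,\dots,n$. Let $\mathcal{A}_k=\{E\in\mathcal{A}: e_{i,j}\in[0,1/k] \text{ for all } i=1,\dots,m,\ j=1,\dots,n\}$, and let $\mathcal{B}_k$ be the set of all matrices in $\mathcal{A}_k$ each of whose entries is either $0$ or $1/k$. Then $\mathcal{A}_k$ is the convex hull of $\mathcal{B}_k$. *)

theory Defs
  imports "HOL-Analysis.Analysis"
begin

(* real ^ 'n ^ 'm: matrices with rows indexed by 'm and columns by 'n, entry E $ i $ j *)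

definition doubly_substochastic :: "(real ^ 'n ^ 'm) set" where
  "doubly_substochastic =
     {E. (\<forall>i j. 0 \<le> E $ i $ j) \<and>
         (\<forall>i. (\<Sum>j\<in>UNIV. E $ i $ j) \<le> 1) \<and>
         (\<forall>j. (\<Sum>i\<in>UNIV. E $ i $ j) \<le> 1)}"

definition substoch_bounded :: "nat \<Rightarrow> (real ^ 'n ^ 'm) set" where
  "substoch_bounded k =
     {E \<in> doubly_substochastic. \<forall>i j. E $ i $ j \<in> {0 .. 1 / real k}}"

definition substoch_two_valued :: "nat \<Rightarrow> (real ^ 'n ^ 'm) set" where
  "substoch_two_valued k =
     {E \<in> substoch_bounded k. \<forall>i j. E $ i $ j = 0 \<or> E $ i $ j = 1 / real k}"

end

theory Submission
  imports Defs
begin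

text \<open>
  After scaling by \<open>k\<close>, this is the integrality of a transportation polytope with integer data: by
  Minkowski's theorem it suffices that its extreme points \<open>E\<close> are integer matrices. View the set
  \<open>F\<close> of positions of the non-integer entries as a bipartite graph between rows and columns. A
  line whose sum is tight, hence an integer, cannot meet \<open>F\<close> in exactly one position. If \<open>F\<close> is
  nonempty, there is a nonzero matrix supported on \<open>F\<close> whose sum vanishes on every line that is not
  a leaf of \<open>F\<close>, and along this direction one can leave \<open>E\<close> both ways inside the polytope.

  The direction exists by counting equations. Let \<open>R\<close> and \<open>C\<close> be the rows and columns of degree at
  least two, so that \<open>2|R| \<le> |F|\<close> and \<open>2|C| \<le> |F|\<close>. If \<open>|R| + |C| < |F|\<close>, there are fewer equations
  than unknowns. Otherwise \<open>F \<subseteq> R \<times> C\<close>, and one equation is redundant because the row sums and the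
  column sums have the same total.
\<close>

subsection \<open>Extreme points and feasible directions\<close>

lemma extreme_point_of_feasible_direction_eq_0:
  fixes x d :: "'a::real_vector"
  assumes ext: "x extreme_point_of S"
    and feasible: "\<forall>\<^sub>F t in nhds (0::real). x + t *\<^sub>R d \<in> S"
  shows "d = 0"
proof (rule ccontr)
  assume "d \<noteq> 0"
  obtain e where "e > 0" and within_e: "\<And>t. dist t 0 < e \<Longrightarrow> x + t *\<^sub>R d \<in> S"
    using feasible unfolding eventually_nhds_metric by blast
  let ?a = "x + (- (e / 2)) *\<^sub>R d" and ?b = "x + (e / 2) *\<^sub>R d"
  have "?a \<in> S" "?b \<in> S"
    using \<open>e > 0\<close> by (auto intro!: within_e simp del: scaleR_minus_left)
  moreover have "x = midpoint ?a ?b"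
    by (simp add: midpoint_def algebra_simps flip: scaleR_2)
  moreover have "?a \<noteq> ?b"
    using \<open>e > 0\<close> \<open>d \<noteq> 0\<close> by (simp flip: scaleR_minus_left)
  ultimately show False
    using ext by (metis extreme_point_of_def midpoint_in_open_segment)
qed

lemma eventually_linear_le_along_direction:
  fixes f :: "'a::real_vector \<Rightarrow> real"
  assumes "linear f" "f x \<le> b" and tight: "f x = b \<Longrightarrow> f d = 0"
  shows "\<forall>\<^sub>F t in nhds 0. f (x + t *\<^sub>R d) \<le> b"
proof -
  have f_along: "f (x + t *\<^sub>R d) = f x + t * f d" for t
    using \<open>linear f\<close> by (simp add: linear_add linear_scale)
  show ?thesis
  proof (cases "f x = b")
    case True
    then show ?thesis by (simp add: f_along tight)
  next
    case False
    have "((\<lambda>t. f x + t * f d) \<longlongrightarrow> f x + 0 * f d) (nhds 0)"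
      by (intro tendsto_intros filterlim_ident)
    then have "\<forall>\<^sub>F t in nhds 0. f x + t * f d < b"
      using False \<open>f x \<le> b\<close> by (intro order_tendstoD(2)) auto
    then show ?thesis
      by (rule eventually_mono) (simp add: f_along)
  qed
qed

subsection \<open>Line sums\<close>

definition row_sum :: "'a::comm_monoid_add ^ 'n ^ 'm \<Rightarrow> 'm \<Rightarrow> 'a" where
  "row_sum E i = (\<Sum>j\<in>UNIV. E $ i $ j)"

definition col_sum :: "'a::comm_monoid_add ^ 'n ^ 'm \<Rightarrow> 'n \<Rightarrow> 'a" where
  "col_sum E j = (\<Sum>i\<in>UNIV. E $ i $ j)"

lemma sum_row_sum_eq_sum_col_sum: "(\<Sum>i\<in>UNIV. row_sum E i) = (\<Sum>j\<in>UNIV. col_sum E j)"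
  unfolding row_sum_def col_sum_def by (rule sum.swap)

lemma row_sum_eq_0_if_other_line_sums_eq_0:
  assumes "\<And>j. col_sum E j = 0" "\<And>i. i \<noteq> i0 \<Longrightarrow> row_sum E i = 0"
  shows "row_sum E i0 = 0"
proof -
  have "row_sum E i0 = (\<Sum>i\<in>UNIV. row_sum E i)"
    using assms(2) by (simp add: sum.remove[of UNIV i0])
  also have "\<dots> = (\<Sum>j\<in>UNIV. col_sum E j)"
    by (rule sum_row_sum_eq_sum_col_sum)
  finally show ?thesis
    by (simp add: assms(1))
qed

lemma linear_row_sum: "linear (\<lambda>E :: real ^ 'n ^ 'm. row_sum E i)"
  by (rule linearI) (simp_all add: row_sum_def sum.distrib sum_distrib_left)

lemma linear_col_sum: "linear (\<lambda>E :: real ^ 'n ^ 'm. col_sum E j)"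
  by (rule linearI) (simp_all add: col_sum_def sum.distrib sum_distrib_left)

lemma inner_axis_one_eq_row_sum: "E \<bullet> axis i 1 = row_sum (E :: real ^ 'n ^ 'm) i"
  by (simp add: inner_axis row_sum_def) (simp add: inner_vec_def)

lemma inner_vec_axis_eq_col_sum: "E \<bullet> (\<chi> i. axis j 1) = col_sum (E :: real ^ 'n ^ 'm) j"
  by (simp add: inner_vec_def[of E] inner_axis col_sum_def)

subsection \<open>Matrices supported on a bipartite graph\<close>

lemma obtain_nonzero_orthogonal:
  fixes W :: "'a::euclidean_space set"
  assumes "finite W" "card W < DIM('a)"
  obtains x where "x \<noteq> 0" "\<And>w. w \<in> W \<Longrightarrow> x \<bullet> w = 0"
proof -
  have "dim W < DIM('a)"
    using dim_le_card'[OF \<open>finite W\<close>] \<open>card W < _\<close> by linarith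
  then obtain x where "x \<noteq> 0" "\<And>y. y \<in> span W \<Longrightarrow> orthogonal x y"
    using orthogonal_to_subspace_exists by blast
  then show thesis
    using that by (simp add: orthogonal_def span_base)
qed

lemma obtain_supported_matrix_zero_line_sums:
  fixes F :: "('m::finite \<times> 'n::finite) set"
  assumes "card R + card C < card F"
  obtains D :: "real ^ 'n ^ 'm" where "D \<noteq> 0" "\<And>i j. (i, j) \<notin> F \<Longrightarrow> D $ i $ j = 0"
    "\<And>i. i \<in> R \<Longrightarrow> row_sum D i = 0" "\<And>j. j \<in> C \<Longrightarrow> col_sum D j = 0"
proof -
  define row_vec :: "'m \<Rightarrow> real ^ 'n ^ 'm" where "row_vec i = axis i 1" for i
  define col_vec :: "'n \<Rightarrow> real ^ 'n ^ 'm" where "col_vec j = (\<chi> i. axis j 1)" for j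
  define unit_vec :: "'m \<times> 'n \<Rightarrow> real ^ 'n ^ 'm" where "unit_vec = (\<lambda>(i, j). axis i (axis j 1))"
  let ?W = "row_vec ` R \<union> col_vec ` C \<union> unit_vec ` (- F)"
  have "card ?W \<le> card (row_vec ` R) + card (col_vec ` C) + card (unit_vec ` (- F))"
    by (meson add_mono card_Un_le le_trans order_refl)
  also have "\<dots> \<le> card R + card C + card (- F)"
    by (intro add_mono card_image_le) auto
  also have "\<dots> < card F + card (- F)"
    using assms by simp
  also have "\<dots> = DIM(real ^ 'n ^ 'm)"
    using card_Un_disjoint[of F "- F"] by simp
  finally obtain D where "D \<noteq> 0" and orth: "\<And>w. w \<in> ?W \<Longrightarrow> D \<bullet> w = 0"
    by (rule obtain_nonzero_orthogonal[rotated]) auto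
  show thesis
  proof (rule that[OF \<open>D \<noteq> 0\<close>])
    show "D $ i $ j = 0" if "(i, j) \<notin> F" for i j
      using orth[OF UnI2, OF imageI, of "(i, j)"] that by (simp add: unit_vec_def inner_axis)
    show "row_sum D i = 0" if "i \<in> R" for i
      using orth[of "row_vec i"] that by (simp add: row_vec_def inner_axis_one_eq_row_sum)
    show "col_sum D j = 0" if "j \<in> C" for j
      using orth[of "col_vec j"] that by (simp add: col_vec_def inner_vec_axis_eq_col_sum)
  qed
qed

lemma mult_card_le_card_Int_Times:
  assumes "finite F" "finite R" and degree: "\<And>i. i \<in> R \<Longrightarrow> n \<le> card (F `` {i})"
  shows "n * card R \<le> card (F \<inter> R \<times> UNIV)"
proof -
  have "of_nat (card R) * n \<le> (\<Sum>i\<in>R. card (F `` {i}))"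
    by (intro sum_bounded_below degree)
  also have "\<dots> = card (SIGMA i:R. F `` {i})"
    using assms by (simp add: finite_Image)
  also have "(SIGMA i:R. F `` {i}) = F \<inter> R \<times> UNIV"
    by auto
  finally show ?thesis
    by (simp add: mult.commute)
qed

lemma card_degree_ge_2_cases:
  assumes "finite F" "finite R" "finite C"
    and rows: "\<And>i. i \<in> R \<Longrightarrow> 2 \<le> card (F `` {i})"
    and cols: "\<And>j. j \<in> C \<Longrightarrow> 2 \<le> card (F\<inverse> `` {j})"
  obtains "card R + card C < card F" | "card R + card C = card F" "F \<subseteq> R \<times> C"
proof -
  have two_rows: "2 * card R \<le> card (F \<inter> R \<times> UNIV)"
    by (intro mult_card_le_card_Int_Times rows) (simp_all add: \<open>finite F\<close> \<open>finite R\<close>)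
  have "2 * card C \<le> card (F\<inverse> \<inter> C \<times> UNIV)"
    by (intro mult_card_le_card_Int_Times cols) (simp_all add: \<open>finite F\<close> \<open>finite C\<close>)
  also have "F\<inverse> \<inter> C \<times> UNIV = (F \<inter> UNIV \<times> C)\<inverse>"
    by auto
  finally have two_cols: "2 * card C \<le> card (F \<inter> UNIV \<times> C)"
    by simp
  have card_Int_le: "card (F \<inter> R \<times> UNIV) \<le> card F" "card (F \<inter> UNIV \<times> C) \<le> card F"
    using \<open>finite F\<close> by (auto intro: card_mono)
  show thesis
  proof (cases "card R + card C < card F")
    case False
    then have "card (F \<inter> R \<times> UNIV) = card F" "card (F \<inter> UNIV \<times> C) = card F"
      using two_rows two_cols card_Int_le by linarith+
    then have "F \<inter> R \<times> UNIV = F" "F \<inter> UNIV \<times> C = F"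
      using \<open>finite F\<close> by (simp_all add: card_subset_eq)
    then have "F \<subseteq> R \<times> UNIV" "F \<subseteq> UNIV \<times> C"
      by (simp_all only: inf.absorb_iff1)
    then have "F \<subseteq> R \<times> C"
      by auto
    moreover have "card R + card C = card F"
      using False two_rows two_cols card_Int_le by linarith
    ultimately show thesis
      by (rule that(2)[rotated])
  qed (rule that(1))
qed

lemma obtain_supported_matrix_zero_degree_ge_2_sums:
  fixes F :: "('m::finite \<times> 'n::finite) set"
  assumes "F \<noteq> {}" and degree_rows: "\<And>i. i \<in> R \<Longrightarrow> 2 \<le> card (F `` {i})"
    and degree_cols: "\<And>j. j \<in> C \<Longrightarrow> 2 \<le> card (F\<inverse> `` {j})"
  obtains D :: "real ^ 'n ^ 'm" where "D \<noteq> 0" "\<And>i j. (i, j) \<notin> F \<Longrightarrow> D $ i $ j = 0"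
    "\<And>i. i \<in> R \<Longrightarrow> row_sum D i = 0" "\<And>j. j \<in> C \<Longrightarrow> col_sum D j = 0"
proof -
  consider (underdetermined) "card R + card C < card F"
    | (balanced) "card R + card C = card F" "F \<subseteq> R \<times> C"
    by (rule card_degree_ge_2_cases[OF _ _ _ degree_rows degree_cols]) simp_all
  then show thesis
  proof cases
    case underdetermined
    from this that show thesis
      by (rule obtain_supported_matrix_zero_line_sums)
  next
    case balanced
    obtain i0 where "i0 \<in> R"
      using \<open>F \<noteq> {}\<close> \<open>F \<subseteq> R \<times> C\<close> by auto
    then have "card (R - {i0}) < card R"
      by (intro card_Diff1_less) simp_all
    then have "card (R - {i0}) + card C < card F"
      using \<open>card R + card C = card F\<close> by linarith
    then obtain D :: "real ^ 'n ^ 'm" where "D \<noteq> 0"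
      and supp: "\<And>i j. (i, j) \<notin> F \<Longrightarrow> D $ i $ j = 0"
      and rows: "\<And>i. i \<in> R - {i0} \<Longrightarrow> row_sum D i = 0"
      and cols: "\<And>j. j \<in> C \<Longrightarrow> col_sum D j = 0"
      using obtain_supported_matrix_zero_line_sums by blast
    have outside: "D $ i $ j = 0" if "i \<notin> R \<or> j \<notin> C" for i j
      using that \<open>F \<subseteq> R \<times> C\<close> by (intro supp) auto
    have "col_sum D j = 0" for j
      using cols by (cases "j \<in> C") (auto simp: col_sum_def outside)
    moreover have other_rows: "row_sum D i = 0" if "i \<noteq> i0" for i
      using rows that by (cases "i \<in> R") (auto simp: row_sum_def outside)
    ultimately have "row_sum D i0 = 0"
      by (rule row_sum_eq_0_if_other_line_sums_eq_0)
    then have "row_sum D i = 0" for i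
      using other_rows by (cases "i = i0") auto
    from \<open>D \<noteq> 0\<close> supp this cols show thesis
      by (rule that)
  qed
qed

lemma obtain_supported_matrix_zero_nonleaf_sums:
  fixes F :: "('m::finite \<times> 'n::finite) set"
  assumes "F \<noteq> {}"
  obtains D :: "real ^ 'n ^ 'm" where "D \<noteq> 0" "\<And>i j. (i, j) \<notin> F \<Longrightarrow> D $ i $ j = 0"
    "\<And>i. card (F `` {i}) \<noteq> 1 \<Longrightarrow> row_sum D i = 0"
    "\<And>j. card (F\<inverse> `` {j}) \<noteq> 1 \<Longrightarrow> col_sum D j = 0"
proof -
  obtain D :: "real ^ 'n ^ 'm" where "D \<noteq> 0"
    and supp: "\<And>i j. (i, j) \<notin> F \<Longrightarrow> D $ i $ j = 0"
    and rows: "\<And>i. 2 \<le> card (F `` {i}) \<Longrightarrow> row_sum D i = 0"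
    and cols: "\<And>j. 2 \<le> card (F\<inverse> `` {j}) \<Longrightarrow> col_sum D j = 0"
    by (rule obtain_supported_matrix_zero_degree_ge_2_sums[OF assms,
          of "{i. 2 \<le> card (F `` {i})}" "{j. 2 \<le> card (F\<inverse> `` {j})}"]) auto
  have isolated_rows: "row_sum D i = 0" if "card (F `` {i}) = 0" for i
    using that by (auto simp: row_sum_def intro!: sum.neutral supp)
  have isolated_cols: "col_sum D j = 0" if "card (F\<inverse> `` {j}) = 0" for j
    using that by (auto simp: col_sum_def intro!: sum.neutral supp)
  show thesis
  proof (rule that[OF \<open>D \<noteq> 0\<close> supp])
    show "row_sum D i = 0" if "card (F `` {i}) \<noteq> 1" for i
      using that rows[of i] isolated_rows[of i] by linarith
    show "col_sum D j = 0" if "card (F\<inverse> `` {j}) \<noteq> 1" for j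
      using that cols[of j] isolated_cols[of j] by linarith
  qed
qed

subsection \<open>Integrality of the transportation polytope\<close>

definition transportation_polytope ::
    "('m \<Rightarrow> real) \<Rightarrow> ('n \<Rightarrow> real) \<Rightarrow> real ^ 'n ^ 'm \<Rightarrow> (real ^ 'n ^ 'm) set" where
  "transportation_polytope r c U =
     {E \<in> {0..U}. (\<forall>i. row_sum E i \<le> r i) \<and> (\<forall>j. col_sum E j \<le> c j)}"

definition integer_matrices :: "('a::ring_1 ^ 'n ^ 'm) set" where
  "integer_matrices = {E. \<forall>i j. E $ i $ j \<in> \<int>}"

lemma mem_transportation_polytope_iff:
  "E \<in> transportation_polytope r c U \<longleftrightarrow> (\<forall>i j. 0 \<le> E $ i $ j \<and> E $ i $ j \<le> U $ i $ j) \<and>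
     (\<forall>i. row_sum E i \<le> r i) \<and> (\<forall>j. col_sum E j \<le> c j)"
  by (auto simp: transportation_polytope_def less_eq_vec_def)

lemma compact_transportation_polytope: "compact (transportation_polytope r c U)"
proof -
  have "closed {E. (\<forall>i. row_sum E i \<le> r i) \<and> (\<forall>j. col_sum E j \<le> c j)}"
    (is "closed ?L")
    unfolding row_sum_def col_sum_def
    by (intro closed_Collect_conj closed_Collect_all closed_Collect_le continuous_intros)
  then have "compact ({0..U} \<inter> ?L)"
    by (intro compact_Int_closed compact_interval)
  also have "{0..U} \<inter> ?L = transportation_polytope r c U"
    by (auto simp: transportation_polytope_def)
  finally show ?thesis .
qed

lemma convex_transportation_polytope: "convex (transportation_polytope r c U)"
  by (rule convexI)
    (auto simp: mem_transportation_polytope_iff linear_add[OF linear_row_sum]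
      linear_add[OF linear_col_sum] linear_scale[OF linear_row_sum] linear_scale[OF linear_col_sum]
      intro!: convex_bound_le)

lemma eventually_transportation_polytope_along_direction:
  fixes E D :: "real ^ 'n::finite ^ 'm::finite"
  assumes mem: "E \<in> transportation_polytope r c U"
    and entries: "\<And>i j. E $ i $ j \<in> {0, U $ i $ j} \<Longrightarrow> D $ i $ j = 0"
    and rows: "\<And>i. row_sum E i = r i \<Longrightarrow> row_sum D i = 0"
    and cols: "\<And>j. col_sum E j = c j \<Longrightarrow> col_sum D j = 0"
  shows "\<forall>\<^sub>F t in nhds 0. E + t *\<^sub>R D \<in> transportation_polytope r c U"
proof -
  have linear_entry: "linear (\<lambda>E :: real ^ 'n ^ 'm. E $ i $ j)" for i :: 'm and j :: 'n
    by (rule linearI) simp_all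
  have "\<forall>\<^sub>F t in nhds 0. - ((E + t *\<^sub>R D) $ i $ j) \<le> 0" for i j
    using mem entries
    by (intro eventually_linear_le_along_direction linear_compose_neg linear_entry)
      (auto simp: mem_transportation_polytope_iff)
  moreover have "\<forall>\<^sub>F t in nhds 0. (E + t *\<^sub>R D) $ i $ j \<le> U $ i $ j" for i j
    using mem entries
    by (intro eventually_linear_le_along_direction linear_entry)
      (auto simp: mem_transportation_polytope_iff)
  moreover have "\<forall>\<^sub>F t in nhds 0. row_sum (E + t *\<^sub>R D) i \<le> r i" for i
    using mem rows
    by (intro eventually_linear_le_along_direction linear_row_sum)
      (auto simp: mem_transportation_polytope_iff)
  moreover have "\<forall>\<^sub>F t in nhds 0. col_sum (E + t *\<^sub>R D) j \<le> c j" for j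
    using mem cols
    by (intro eventually_linear_le_along_direction linear_col_sum)
      (auto simp: mem_transportation_polytope_iff)
  ultimately show ?thesis
    unfolding mem_transportation_polytope_iff neg_le_0_iff_le
    by (intro eventually_conj eventually_all_finite)
qed

lemma sum_in_Ints_imp_card_notin_Ints_neq_1:
  fixes f :: "'a \<Rightarrow> 'b::ring_1"
  assumes "finite A" "sum f A \<in> \<int>"
  shows "card {x \<in> A. f x \<notin> \<int>} \<noteq> 1"
proof
  assume "card {x \<in> A. f x \<notin> \<int>} = 1"
  then obtain a where only_a: "{x \<in> A. f x \<notin> \<int>} = {a}"
    by (rule card_1_singletonE)
  then have "sum f (A - {a}) \<in> \<int>"
    by (intro Ints_sum) auto
  moreover have "f a = sum f A - sum f (A - {a})"
    using only_a \<open>finite A\<close> by (simp add: sum_diff1) blast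
  ultimately have "f a \<in> \<int>"
    using \<open>sum f A \<in> \<int>\<close> by simp
  then show False
    using only_a by blast
qed

lemma extreme_point_transportation_polytope_integer:
  fixes E :: "real ^ 'n::finite ^ 'm::finite"
  assumes ext: "E extreme_point_of transportation_polytope r c U"
    and r_Ints: "\<And>i. r i \<in> \<int>" and c_Ints: "\<And>j. c j \<in> \<int>" and U_integer: "U \<in> integer_matrices"
  shows "E \<in> integer_matrices"
proof (rule ccontr)
  define F where "F = {(i, j). E $ i $ j \<notin> \<int>}"
  assume "E \<notin> integer_matrices"
  then have "F \<noteq> {}"
    by (auto simp: integer_matrices_def F_def)
  obtain D :: "real ^ 'n ^ 'm" where "D \<noteq> 0"
    and supp: "\<And>i j. (i, j) \<notin> F \<Longrightarrow> D $ i $ j = 0"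
    and rows: "\<And>i. card (F `` {i}) \<noteq> 1 \<Longrightarrow> row_sum D i = 0"
    and cols: "\<And>j. card (F\<inverse> `` {j}) \<noteq> 1 \<Longrightarrow> col_sum D j = 0"
    using obtain_supported_matrix_zero_nonleaf_sums[OF \<open>F \<noteq> {}\<close>] by blast
  have "\<forall>\<^sub>F t in nhds 0. E + t *\<^sub>R D \<in> transportation_polytope r c U"
  proof (rule eventually_transportation_polytope_along_direction)
    show "E \<in> transportation_polytope r c U"
      using ext by (simp add: extreme_point_of_def)
    show "D $ i $ j = 0" if "E $ i $ j \<in> {0, U $ i $ j}" for i j
      using that U_integer by (intro supp) (auto simp: F_def integer_matrices_def)
    show "row_sum D i = 0" if "row_sum E i = r i" for i
      using sum_in_Ints_imp_card_notin_Ints_neq_1[of UNIV "\<lambda>j. E $ i $ j"] that r_Ints[of i]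
      by (intro rows) (simp add: row_sum_def F_def Image_singleton)
    show "col_sum D j = 0" if "col_sum E j = c j" for j
      using sum_in_Ints_imp_card_notin_Ints_neq_1[of UNIV "\<lambda>i. E $ i $ j"] that c_Ints[of j]
      by (intro cols) (simp add: col_sum_def F_def Image_singleton)
  qed
  then have "D = 0"
    using ext by (rule extreme_point_of_feasible_direction_eq_0[rotated])
  with \<open>D \<noteq> 0\<close> show False ..
qed

theorem transportation_polytope_eq_convex_hull_integer_matrices:
  fixes U :: "real ^ 'n::finite ^ 'm::finite"
  assumes "\<And>i. r i \<in> \<int>" "\<And>j. c j \<in> \<int>" "U \<in> integer_matrices"
  shows "transportation_polytope r c U =
    convex hull (transportation_polytope r c U \<inter> integer_matrices)"
proof
  have "transportation_polytope r c U =
      convex hull {E. E extreme_point_of transportation_polytope r c U}"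
    by (intro Krein_Milman_Minkowski compact_transportation_polytope
        convex_transportation_polytope)
  also have "\<dots> \<subseteq> convex hull (transportation_polytope r c U \<inter> integer_matrices)"
    using assms
    by (intro hull_mono)
      (auto simp: extreme_point_of_def extreme_point_transportation_polytope_integer)
  finally show "transportation_polytope r c U \<subseteq>
      convex hull (transportation_polytope r c U \<inter> integer_matrices)" .
  show "convex hull (transportation_polytope r c U \<inter> integer_matrices)
      \<subseteq> transportation_polytope r c U"
    by (intro hull_minimal convex_transportation_polytope) simp
qed

subsection \<open>Doubly substochastic matrices\<close>

lemma scaleR_image_eq_Collect:
  fixes S :: "'a::real_vector set"
  assumes "a \<noteq> 0"
  shows "(*\<^sub>R) a ` S = {x. inverse a *\<^sub>R x \<in> S}"
proof (intro set_eqI iffI)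
  fix x assume "x \<in> {x. inverse a *\<^sub>R x \<in> S}"
  then show "x \<in> (*\<^sub>R) a ` S"
    using assms by (intro image_eqI[of _ _ "inverse a *\<^sub>R x"]) simp_all
qed (use assms in auto)

lemma substoch_bounded_eq_scaled_transportation_polytope:
  assumes "k > 0"
  shows "substoch_bounded k =
    (*\<^sub>R) (1 / real k) ` transportation_polytope (\<lambda>_. real k) (\<lambda>_. real k) (\<chi> i j. 1)"
  using assms
  by (auto simp: substoch_bounded_def doubly_substochastic_def scaleR_image_eq_Collect
      mem_transportation_polytope_iff row_sum_def col_sum_def zero_le_mult_iff field_simps
      simp flip: sum_distrib_left)

lemma substoch_two_valued_eq_Int_scaled_integer_matrices:
  assumes "k > 0"
  shows "(substoch_two_valued k :: (real ^ 'n ^ 'm) set) =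
    substoch_bounded k \<inter> (*\<^sub>R) (1 / real k) ` integer_matrices"
proof -
  have scaled_Ints_iff: "real k * x \<in> \<int> \<longleftrightarrow> x = 0 \<or> x = 1 / real k"
    if "0 \<le> x" "x \<le> 1 / real k" for x
  proof
    assume "real k * x \<in> \<int>"
    then obtain z where z_eq: "real k * x = of_int z"
      by (rule Ints_cases)
    moreover have "0 \<le> real k * x" "real k * x \<le> 1"
      using that assms by (simp_all add: field_simps)
    ultimately have "z = 0 \<or> z = 1"
      by auto
    then show "x = 0 \<or> x = 1 / real k"
      using z_eq assms by (auto simp: field_simps)
  qed (use assms in auto)
  have "real k *\<^sub>R E \<in> integer_matrices \<longleftrightarrow> (\<forall>i j. E $ i $ j = 0 \<or> E $ i $ j = 1 / real k)"
    if "E \<in> substoch_bounded k" for E :: "real ^ 'n ^ 'm"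
    using that by (simp add: integer_matrices_def substoch_bounded_def scaled_Ints_iff)
  then show ?thesis
    using assms by (auto simp: substoch_two_valued_def scaleR_image_eq_Collect)
qed

theorem theorem1:
  fixes k :: nat
  assumes "k > 0"
  shows "(substoch_bounded k :: (real ^ 'n::finite ^ 'm::finite) set) = convex hull (substoch_two_valued k)"
proof -
  define T :: "(real ^ 'n ^ 'm) set"
    where "T = transportation_polytope (\<lambda>_. real k) (\<lambda>_. real k) (\<chi> i j. 1)"
  have bounded: "substoch_bounded k = (*\<^sub>R) (1 / real k) ` T"
    unfolding T_def using assms by (rule substoch_bounded_eq_scaled_transportation_polytope)
  have "T = convex hull (T \<inter> integer_matrices)"
    unfolding T_def
    by (rule transportation_polytope_eq_convex_hull_integer_matrices)
      (simp_all add: integer_matrices_def)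
  then have "substoch_bounded k = convex hull ((*\<^sub>R) (1 / real k) ` (T \<inter> integer_matrices))"
    using bounded convex_hull_scaling by metis
  also have "(*\<^sub>R) (1 / real k) ` (T \<inter> integer_matrices) = substoch_two_valued k"
    using assms by (simp add: substoch_two_valued_eq_Int_scaled_integer_matrices bounded
        image_Int inj_on_def)
  finally show ?thesis .
qed

end
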